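(* Let $s \ge 2$ and let $\sigma$ be a string of length $n$ over the alphabet $\Sigma = T \cup \bar{T}$ with $|T| = s$. Let $d$ be the optimal edit distance from $\sigma$ to $\mathrm{Dyck}(s)$. Then the algorithm Random-deletion runs in linear time and, with constant probability, outputs a well-balanced string whose edit distance from $\sigma$ is within a factor $4d$ of the optimum, i.e. Random-deletion obtains a $4d$-approximation for edit distance (insertions, deletions, substitutions) to $\mathrm{Dyck}(s)$.
   Context: $T$ is a finite set of open parentheses; each $x \in T$ has a unique congruent (matching) close parenthesis $\bar{x}$, and $\bar{T} = \{\bar{x} : x \in T\}$. $\mathrm{Dyck}(s)$, $s = |T|$, is the language of well-balanced strings over $T \cup \bar{T}$, generated by $S \to SS$, $S \to \varepsilon$, $S \to a S \bar{a}$ for all $a \in T$. The edit distance from $\sigma$ to $\mathrm{Dyck}(s)$ is the minimum number of single-symbol insertions, deletions and substitutions needed to turn $\sigma$ into a string of $\mathrm{Dyck}(s)$. Random-deletion: initialize an empty stack and scan $\sigma$ left to right. If the current symbol is an open parenthesis, push it. If it is a close parenthesis: if the stack is empty, delete the current symbol; if the stack top is the matching open parenthesis, match (pop) them; otherwise delete either the stack top or the current symbol, each with probability $1/2$ independently of everything else. When the scan ends, delete all symbols remaining in the stack. The output is the resulting well-balanced string. *)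

theory Defs
  imports "HOL-Probability.Probability"
begin

text \<open>
  The two alphabets $T$ and $\bar T$ are represented by a set \<open>T\<close> of parenthesis types:
  \<open>Op x\<close> is the open parenthesis of type \<open>x\<close> and \<open>Cl x\<close> its unique congruent close parenthesis.
\<close>

datatype 'a paren = Op 'a | Cl 'a

definition alphabet :: "'a set \<Rightarrow> 'a paren set" where
  "alphabet T = Op ` T \<union> Cl ` T"

inductive_set Dyck :: "'a set \<Rightarrow> 'a paren list set" for T :: "'a set" where
  concat: "u \<in> Dyck T \<Longrightarrow> v \<in> Dyck T \<Longrightarrow> u @ v \<in> Dyck T"
| empty: "[] \<in> Dyck T"
| wrap: "a \<in> T \<Longrightarrow> u \<in> Dyck T \<Longrightarrow> [Op a] @ u @ [Cl a] \<in> Dyck T"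

inductive edit_step :: "'b list \<Rightarrow> 'b list \<Rightarrow> bool" where
  insertion: "edit_step (u @ v) (u @ [x] @ v)"
| deletion: "edit_step (u @ [x] @ v) (u @ v)"
| substitution: "edit_step (u @ [x] @ v) (u @ [y] @ v)"

definition edit_dist :: "'b list \<Rightarrow> 'b list \<Rightarrow> nat" where
  "edit_dist u v = (LEAST k. (edit_step ^^ k) u v)"

definition edit_dist_lang :: "'b list \<Rightarrow> 'b list set \<Rightarrow> nat" where
  "edit_dist_lang u L = (INF v\<in>L. edit_dist u v)"

text \<open>
  Random-deletion is a randomized program that returns its result together with its running time,
  counted in the unit-cost RAM model. The stack holds the open parentheses together with their
  positions in the input, and deletions are recorded by marking input positions in a bit array,
  represented by the set \<open>D\<close> of the marked positions. The elementary operations, of cost 1 each,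
  are: testing for the end of the input, reading the current symbol, advancing to the next symbol,
  testing whether the stack is empty, pushing, popping, comparing the stack top with the current
  symbol, flipping a coin, writing a mark, reading a mark, and writing an output symbol.
\<close>

definition charge :: "nat \<Rightarrow> ('r \<times> nat) pmf \<Rightarrow> ('r \<times> nat) pmf" where
  "charge c p = map_pmf (\<lambda>(r, t). (r, c + t)) p"

fun clear_stack :: "nat set \<Rightarrow> (nat \<times> 'a) list \<Rightarrow> nat set \<times> nat" where
  "clear_stack D [] = (D, 1)"
| "clear_stack D ((j, a) # st) =
    (let (D', t) = clear_stack (insert j D) st
     in (D', 3 + t))" \<comment> \<open>stack test, pop, mark\<close>

text \<open>
  The arguments are the marked positions, the stack (top first), and the unread input, each symbol
  paired with its position. When the stack top is deleted, the close parenthesis stays the current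
  symbol.
\<close>

fun scan :: "nat set \<Rightarrow> (nat \<times> 'a) list \<Rightarrow> (nat \<times> 'a paren) list \<Rightarrow> (nat set \<times> nat) pmf" where
  "scan D st [] =
    charge 1 (return_pmf (clear_stack D st))" \<comment> \<open>end test\<close>
| "scan D st ((i, Op a) # xs) =
    charge 4 (scan D ((i, a) # st) xs)" \<comment> \<open>end test, read, push, advance\<close>
| "scan D [] ((i, Cl b) # xs) =
    charge 5 (scan (insert i D) [] xs)" \<comment> \<open>end test, read, stack test, mark, advance\<close>
| "scan D ((j, a) # st) ((i, Cl b) # xs) =
    (if a = b
     then charge 6 (scan D st xs) \<comment> \<open>end test, read, stack test, compare, pop, advance\<close>
     else do {
       coin \<leftarrow> bernoulli_pmf (1/2);
       if coin
       then charge 7 (scan (insert j D) st ((i, Cl b) # xs))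
         \<comment> \<open>end test, read, stack test, compare, flip, pop, mark\<close>
       else charge 7 (scan (insert i D) ((j, a) # st) xs)
         \<comment> \<open>end test, read, stack test, compare, flip, mark, advance\<close>
     })"

fun emit :: "nat set \<Rightarrow> (nat \<times> 'b) list \<Rightarrow> 'b list \<times> nat" where
  "emit D [] = ([], 1)"
| "emit D ((i, x) # xs) =
    (let (w, t) = emit D xs
     in if i \<in> D then (w, 3 + t) \<comment> \<open>end test, read mark, advance\<close>
        else (x # w, 5 + t))" \<comment> \<open>additionally: read symbol, write it to the output\<close>

text \<open>The initial charge pays for clearing the \<open>length \<sigma>\<close> marks and creating the empty stack.\<close>

definition random_deletion :: "'a paren list \<Rightarrow> ('a paren list \<times> nat) pmf" where
  "random_deletion \<sigma> =
    charge (length \<sigma> + 1) (do {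
      (D, t) \<leftarrow> scan {} [] (List.enumerate 0 \<sigma>);
      charge t (return_pmf (emit D (List.enumerate 0 \<sigma>)))
    })"

end

theory Submission
  imports Defs
begin

text \<open>
  The potential is the number of deletions that balance the stack followed by the unread input;
  it is at most \<open>2 * d\<close> initially, because every edit operation can be simulated by two deletions.
  At a mismatch every optimal solution deletes the stack top or the current symbol, so a fair coin
  decreases the potential with probability at least \<open>1/2\<close> and otherwise raises it by at most one.
  Hence the number of deletions is dominated by the hitting time of 0 of a simple random walk
  started at \<open>2 * d\<close>, which is at most \<open>(2 * d)\<^sup>2\<close> with constant probability.
\<close>

section \<open>Deletion distance\<close>

text \<open>This follows the recursion of \<open>scan\<close> with the coin replaced by the better
  outcome, so it is the least number of deletions over all coin sequences.\<close>

fun del_dist :: "'a list \<Rightarrow> 'a paren list \<Rightarrow> nat" where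
  "del_dist st [] = length st"
| "del_dist st (Op a # xs) = del_dist (a # st) xs"
| "del_dist [] (Cl b # xs) = Suc (del_dist [] xs)"
| "del_dist (a # st) (Cl b # xs) =
    (if a = b then del_dist st xs
     else Suc (min (del_dist st (Cl b # xs)) (del_dist (a # st) xs)))"

definition near :: "nat \<Rightarrow> nat \<Rightarrow> bool" where
  "near x y \<longleftrightarrow> x \<le> Suc y \<and> y \<le> Suc x"

text \<open>The assumption is the stack property for the shorter input \<open>xs\<close>; it is the
  induction hypothesis when this bound is used to prove that property.\<close>

lemma near_del_dist_Cl:
  assumes "\<And>A c B. near (del_dist (A @ c # B) xs) (del_dist (A @ B) xs)"
  shows "near (del_dist st (Cl b # xs)) (del_dist st xs)"
proof (induction st)
  case Nil
  then show ?case by (simp add: near_def)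
next
  case (Cons a st)
  have "near (del_dist (a # st) xs) (del_dist st xs)"
    using assms[of "[]"] by simp
  with Cons show ?case by (auto simp: near_def)
qed

text \<open>The extra symbol may lie anywhere in the stack, since reading an open parenthesis buries
  it under a new top.\<close>

lemma near_del_dist_stack: "near (del_dist (A @ c # B) xs) (del_dist (A @ B) xs)"
proof (induction xs arbitrary: A c B)
  case Nil
  then show ?case by (simp add: near_def)
next
  case (Cons x xs)
  show ?case
  proof (cases x)
    case (Op a)
    then show ?thesis using Cons[of "a # A"] by simp
  next
    case (Cl b)
    have inp: "near (del_dist st (Cl b # xs)) (del_dist st xs)" for st
      by (rule near_del_dist_Cl) (rule Cons)
    have "near (del_dist (A @ c # B) (Cl b # xs)) (del_dist (A @ B) (Cl b # xs))"
    proof (induction A)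
      case Nil
      then show ?case using inp[of B] Cons[of "[]" c B] by (auto simp: near_def)
    next
      case (Cons a A)
      then show ?case
        using \<open>near (del_dist (A @ c # B) xs) (del_dist (A @ B) xs)\<close>
          \<open>near (del_dist ((a # A) @ c # B) xs) (del_dist ((a # A) @ B) xs)\<close>
        by (auto simp: near_def)
    qed
    then show ?thesis using Cl by simp
  qed
qed

lemma near_del_dist_Cons: "near (del_dist st (x # xs)) (del_dist st xs)"
  using near_del_dist_Cl[OF near_del_dist_stack] near_del_dist_stack[of "[]"]
  by (cases x) auto

lemma near_del_dist_input: "near (del_dist st (u @ x # v)) (del_dist st (u @ v))"
  by (induction st u rule: del_dist.induct) (use near_del_dist_Cons in \<open>auto simp: near_def\<close>)

text \<open>A substitution is a deletion followed by an insertion, each changing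
  \<open>del_dist\<close> by at most one. This 2 is squared into the 4 of the approximation
  factor.\<close>

lemma del_dist_edit_step:
  assumes "edit_step u v"
  shows "del_dist [] u \<le> del_dist [] v + 2"
  using assms
proof cases
  case (insertion u' v' x)
  then show ?thesis using near_del_dist_input[of "[]" u' x v'] by (simp add: near_def)
next
  case (deletion u' x v')
  then show ?thesis using near_del_dist_input[of "[]" u' x v'] by (simp add: near_def)
next
  case (substitution u' x v' y)
  then show ?thesis
    using near_del_dist_input[of "[]" u' x v'] near_del_dist_input[of "[]" u' y v']
    by (simp add: near_def)
qed

lemma del_dist_edit_steps:
  "(edit_step ^^ k) u v \<Longrightarrow> del_dist [] u \<le> del_dist [] v + 2 * k"
proof (induction k arbitrary: u)
  case 0
  then show ?case by simp
next
  case (Suc k)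
  then obtain u' where "edit_step u u'" "(edit_step ^^ k) u' v"
    by (meson relpowp_Suc_D2)
  then show ?case using Suc.IH del_dist_edit_step by fastforce
qed

text \<open>An arbitrary stack and continuation let the induction pass through concatenation and
  below an enclosing pair.\<close>

lemma del_dist_Dyck_append: "u \<in> Dyck T \<Longrightarrow> del_dist st (u @ xs) = del_dist st xs"
  by (induction u arbitrary: st xs rule: Dyck.induct) auto

section \<open>Edit distance\<close>

lemma edit_step_Cons: "edit_step u v \<Longrightarrow> edit_step (x # u) (x # v)"
proof (induction rule: edit_step.induct)
  case (insertion u v y)
  then show ?case using edit_step.insertion[of "x # u" v y] by simp
next
  case (deletion u y v)
  then show ?case using edit_step.deletion[of "x # u" y v] by simp
next
  case (substitution u y v z)
  then show ?case using edit_step.substitution[of "x # u" y v z] by simp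
qed

lemma edit_steps_Cons: "(edit_step ^^ k) u v \<Longrightarrow> (edit_step ^^ k) (x # u) (x # v)"
  by (induction k arbitrary: v) (auto dest: edit_step_Cons)

text \<open>A path through the empty word always exists, so the \<open>LEAST\<close> in
  \<open>edit_dist\<close> is attained.\<close>

lemma edit_steps_total: "\<exists>k. (edit_step ^^ k) u v"
proof -
  have "edit_step\<^sup>*\<^sup>* u []"
  proof (induction u)
    case (Cons x u)
    then show ?case
      using edit_step.deletion[of "[]" x u] by (auto intro: converse_rtranclp_into_rtranclp)
  qed simp
  moreover have "edit_step\<^sup>*\<^sup>* [] v"
  proof (induction v)
    case (Cons x v)
    then show ?case
      using edit_step.insertion[of "[]" v x] by (auto intro: rtranclp.rtrancl_into_rtrancl)
  qed simp
  ultimately show ?thesis by (metis rtranclp_imp_relpowp rtranclp_trans)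
qed

lemma edit_dist_steps: "(edit_step ^^ edit_dist u v) u v"
  unfolding edit_dist_def using edit_steps_total by (rule LeastI_ex)

lemma del_dist_le_edit_dist_lang: "del_dist [] u \<le> 2 * edit_dist_lang u (Dyck T)"
proof -
  \<comment> \<open>An infimum over a nonempty set of naturals is attained.\<close>
  have "edit_dist_lang u (Dyck T) \<in> edit_dist u ` Dyck T"
    unfolding edit_dist_lang_def by (rule Inf_nat_def1) (use Dyck.empty in auto)
  then obtain v where v: "v \<in> Dyck T" "edit_dist_lang u (Dyck T) = edit_dist u v"
    by auto
  have "del_dist [] v = 0"
    using del_dist_Dyck_append[OF v(1), of "[]" "[]"] by simp
  then show ?thesis
    using del_dist_edit_steps[OF edit_dist_steps[of u v]] v(2) by simp
qed

text \<open>The map \<open>f\<close> separates the choice of what to delete, later made by position,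
  from the symbols of the word.\<close>

lemma edit_steps_filter:
  "(edit_step ^^ length (filter P xs)) (map f xs) (map f (filter (\<lambda>x. \<not> P x) xs))"
proof (induction xs)
  case (Cons x xs)
  have "edit_step (f x # map f xs) (map f xs)"
    using edit_step.deletion[of "[]"] by simp
  with Cons show ?case
    by (auto intro: edit_steps_Cons relpowp_Suc_I2 simp del: relpowp.simps)
qed simp

section \<open>Hitting times of the simple random walk\<close>

text \<open>
  \<open>hit k m\<close> is the probability that the walk started at \<open>k\<close> reaches 0 within \<open>m\<close> steps.
\<close>

fun hit :: "nat \<Rightarrow> nat \<Rightarrow> real" where
  "hit 0 m = 1"
| "hit (Suc k) 0 = 0"
| "hit (Suc k) (Suc m) = (hit k m + hit (Suc (Suc k)) m) / 2"

lemma hit_nonneg: "0 \<le> hit k m"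
  by (induction k m rule: hit.induct) auto

lemma hit_le_1: "hit k m \<le> 1"
  by (induction k m rule: hit.induct) auto

lemma hit_eq_0: "m < k \<Longrightarrow> hit k m = 0"
  by (induction k m rule: hit.induct) auto

lemma hit_Suc_start_le: "hit (Suc k) m \<le> hit k m"
proof (induction m arbitrary: k)
  case 0
  then show ?case by (cases k) auto
next
  case (Suc m)
  show ?case
  proof (cases k)
    case 0
    then show ?thesis using hit_le_1 by simp
  next
    case (Suc j)
    then show ?thesis using Suc.IH[of j] Suc.IH[of "Suc (Suc j)"] by simp
  qed
qed

lemma hit_antimono_start: "k \<le> k' \<Longrightarrow> hit k' m \<le> hit k m"
  by (rule lift_Suc_antimono_le[of "\<lambda>k. hit k m"]) (rule hit_Suc_start_le)

lemma hit_le_hit_Suc_time: "hit k m \<le> hit k (Suc m)"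
proof (induction k m rule: hit.induct)
  case (2 k)
  then show ?case using hit_nonneg[of "Suc k" "Suc 0"] by simp
next
  case (3 k m)
  then show ?case
    unfolding hit.simps(3)[of k m] hit.simps(3)[of k "Suc m"]
    by (intro divide_right_mono add_mono) auto
qed simp

lemma hit_mono_time: "m \<le> m' \<Longrightarrow> hit k m \<le> hit k m'"
  by (rule lift_Suc_mono_le[of "hit k"]) (rule hit_le_hit_Suc_time)

text \<open>One way down from \<open>k + j\<close> to 0 is to descend \<open>k\<close> levels within
  \<open>m\<close> steps and then \<open>j\<close> levels within \<open>n\<close> further
  steps.\<close>

lemma hit_add: "hit k m * hit j n \<le> hit (k + j) (m + n)"
proof (induction k m rule: hit.induct)
  case (1 m)
  then show ?case using hit_mono_time[of n "m + n" j] by simp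
next
  case (2 k)
  then show ?case using hit_nonneg by simp
next
  case (3 k m)
  then show ?case by (simp add: field_simps)
qed

lemma hit_mult: "hit k m ^ r \<le> hit (r * k) (r * m)"
proof (induction r)
  case (Suc r)
  have "hit k m ^ Suc r \<le> hit k m * hit (r * k) (r * m)"
    using Suc hit_nonneg by (simp add: mult_left_mono)
  also have "\<dots> \<le> hit (Suc r * k) (Suc r * m)"
    using hit_add by simp
  finally show ?case .
qed simp

text \<open>
  The right-hand side is a martingale: \<open>1 - k / L\<close> is the probability of reaching 0 before \<open>L\<close>, and
  the last term is Markov's bound on the probability that this takes more than \<open>M\<close> steps in all.
\<close>

lemma hit_ge_barrier:
  assumes "0 < L" "0 < M" "m \<le> M" "k \<le> L"
  shows "hit k m \<ge> 1 - real k / real L - (real k * (real L - real k) + (real M - real m)) / real M"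
  using assms(3,4)
proof (induction k m rule: hit.induct)
  case (1 m)
  then show ?case using assms by simp
next
  case (2 k)
  have "0 \<le> real (Suc k) * (real L - real (Suc k)) / real M"
    using 2 by (intro divide_nonneg_nonneg mult_nonneg_nonneg) auto
  moreover have "0 \<le> real (Suc k) / real L" by simp
  moreover have "real M / real M = 1" using assms by simp
  ultimately show ?case
    unfolding hit.simps add_divide_distrib of_nat_0 diff_zero by linarith
next
  case (3 k m)
  show ?case
  proof (cases "Suc k = L")
    case True
    \<comment> \<open>At the barrier the claimed lower bound is at most 0.\<close>
    have "0 \<le> (real M - real (Suc m)) / real M"
      using 3 by (intro divide_nonneg_nonneg) auto
    then show ?thesis
      using hit_nonneg[of "Suc k" "Suc m"] True assms by simp
  next
    case False
    let ?g = "\<lambda>(k::real) (m::real). 1 - k / real L - (k * (real L - k) + (real M - m)) / real M"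
    \<comment> \<open>Averaging over one step lowers \<open>k * (L - k)\<close> by one, while the
      elapsed time \<open>M - m\<close> grows by one.\<close>
    have "?g (real (Suc k)) (real (Suc m)) = (?g (real k) (real m) + ?g (real (Suc (Suc k))) (real m)) / 2"
      using assms by (simp add: field_simps)
    also have "\<dots> \<le> hit (Suc k) (Suc m)"
      unfolding hit.simps by (intro divide_right_mono add_mono 3) (use 3 False in auto)
    finally show ?thesis .
  qed
qed

text \<open>With the barrier at \<open>2 * k\<close> the bound becomes 1 - 1/2 - 1/3.\<close>

lemma hit_three_squares: "0 < k \<Longrightarrow> hit k (3 * k\<^sup>2) \<ge> 1 / 6"
  using hit_ge_barrier[of "2 * k" "3 * k\<^sup>2" "3 * k\<^sup>2" k]
  by (simp add: field_simps power2_eq_square)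

lemma hit_self: "hit k k \<ge> (1 / 2) ^ k"
proof (induction k)
  case (Suc k)
  then show ?case using hit_nonneg[of "Suc (Suc k)" k] by simp
qed simp

text \<open>Splitting the descent into \<open>r\<close> equal stages divides the time
  \<open>3 * k\<^sup>2\<close> by \<open>r\<close>; taking \<open>r = 12\<close> leaves room for
  rounding. For small \<open>k\<close> the straight descent suffices.\<close>

lemma hit_square: "hit k (k\<^sup>2) \<ge> (1 / 6) ^ 12"
proof (cases "k \<le> 12")
  case True
  have "(1 / 6) ^ 12 \<le> (1 / 2 :: real) ^ 12"
    by (rule power_mono) auto
  also have "\<dots> \<le> (1 / 2) ^ k"
    using True by (intro power_decreasing) auto
  also have "\<dots> \<le> hit k k" by (rule hit_self)
  also have "\<dots> \<le> hit k (k\<^sup>2)"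
    by (rule hit_mono_time) (simp add: power2_eq_square)
  finally show ?thesis .
next
  case False
  \<comment> \<open>This is \<open>k / 12\<close> rounded up. As \<open>k > 12\<close>, it satisfies
    \<open>6 * j \<le> k\<close>, and twelve stages of \<open>3 * j\<^sup>2\<close> steps take
    \<open>(6 * j)\<^sup>2\<close> steps.\<close>
  define j where "j = (k + 11) div 12"
  have j: "k \<le> 12 * j" "12 * j \<le> k + 11" "0 < j"
    using False by (auto simp: j_def)
  have "6 * j \<le> k" using j False by simp
  then have "(6 * j)\<^sup>2 \<le> k\<^sup>2" by (rule power_mono) simp
  then have time: "12 * (3 * j\<^sup>2) \<le> k\<^sup>2" by (simp add: power_mult_distrib)
  have "(1 / 6) ^ 12 \<le> hit j (3 * j\<^sup>2) ^ 12"
    using hit_three_squares j by (intro power_mono) auto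
  also have "\<dots> \<le> hit (12 * j) (12 * (3 * j\<^sup>2))" by (rule hit_mult)
  also have "\<dots> \<le> hit k (12 * (3 * j\<^sup>2))" using j(1) by (rule hit_antimono_start)
  also have "\<dots> \<le> hit k (k\<^sup>2)" using time by (rule hit_mono_time)
  finally show ?thesis .
qed

section \<open>Number of deletions\<close>

lemma prob_charge: "measure_pmf.prob (charge c p) {(r, t). Q r} = measure_pmf.prob p {(r, t). Q r}"
  by (simp add: charge_def vimage_def case_prod_unfold)

lemma prob_coin_bind:
  "measure_pmf.prob (bernoulli_pmf (1/2) \<bind> f) A =
    (measure_pmf.prob (f True) A + measure_pmf.prob (f False) A) / 2"
proof -
  have "measure_pmf.prob (bernoulli_pmf (1/2) \<bind> f) A =
      measure_pmf.expectation (bernoulli_pmf (1/2)) (\<lambda>b. measure_pmf.prob (f b) A)"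
    by (simp add: measure_pmf_bind measure_subprob
        measure_pmf.measure_bind[where N = "count_space UNIV"])
  then show ?thesis by simp
qed

lemma card_clear_stack: "card (fst (clear_stack D st)) \<le> card D + length st"
proof (induction D st rule: clear_stack.induct)
  case (2 D j a st)
  have "card (insert j D) \<le> Suc (card D)" by (rule card_insert_le_m1) auto
  with 2 show ?case by (auto simp: case_prod_unfold Let_def)
qed simp

text \<open>A mark uses up at most one unit of the deletion budget, which is the time of the
  walk.\<close>

lemma prob_scan_card_insert:
  assumes "hit k m \<le> measure_pmf.prob (scan (insert i D) st xs) {(D', t). card D' \<le> card (insert i D) + m}"
  shows "hit k m \<le> measure_pmf.prob (scan (insert i D) st xs) {(D', t). card D' \<le> card D + Suc m}"
proof -
  have "card (insert i D) \<le> Suc (card D)" by (rule card_insert_le_m1) auto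
  then show ?thesis
    using assms by (elim order_trans) (auto intro!: measure_pmf.finite_measure_mono)
qed

text \<open>Deletions act as time and \<open>del_dist\<close> as the position of the walk. Pushes
  and matches change neither; each deletion during the scan is compared with one step of the
  walk.\<close>

lemma prob_scan_card:
  "hit (del_dist (map snd st) (map snd xs)) m
    \<le> measure_pmf.prob (scan D st xs) {(D', t). card D' \<le> card D + m}"
proof (induction D st xs arbitrary: m rule: scan.induct)
  case (1 D st)
  show ?case
  proof (cases "length st \<le> m")
    case True
    then have "card (fst (clear_stack D st)) \<le> card D + m"
      using card_clear_stack[of D st] by simp
    then have "measure_pmf.prob (scan D st []) {(D', t). card D' \<le> card D + m} = 1"
      by (simp add: prob_charge) (simp add: indicator_def case_prod_beta')
    then show ?thesis using hit_le_1 by simp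
  next
    case False
    then show ?thesis by (simp add: hit_eq_0)
  qed
next
  case (2 D st i a xs)
  then show ?case by (simp add: prob_charge)
next
  case (3 D i b xs)
  show ?case
  proof (cases m)
    case (Suc m')
    \<comment> \<open>A forced deletion surely lowers the potential, which is at least as good as a
      fair step.\<close>
    have "hit (Suc (del_dist [] (map snd xs))) m \<le> hit (del_dist [] (map snd xs)) m'"
      using hit_antimono_start[of "del_dist [] (map snd xs)" "Suc (Suc (del_dist [] (map snd xs)))" m'] Suc
      by simp
    also have "\<dots> \<le> measure_pmf.prob (scan (insert i D) [] xs) {(D', t). card D' \<le> card D + m}"
      using prob_scan_card_insert 3[of m'] Suc by simp
    finally show ?thesis by (simp add: prob_charge)
  qed simp
next
  case (4 D j a st i b xs)
  show ?case
  proof (cases "a = b")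
    case True
    then show ?thesis using 4(1) by (simp add: prob_charge)
  next
    case neq: False
    show ?thesis
    proof (cases m)
      case 0
      then show ?thesis using neq by simp
    next
      case (Suc m')
      let ?A = "{(D', t :: nat). card D' \<le> card D + m}"
      let ?x = "del_dist (map snd st) (map snd ((i, Cl b) # xs))"
      let ?y = "del_dist (map snd ((j, a) # st)) (map snd xs)"
      have x: "hit ?x m' \<le> measure_pmf.prob (scan (insert j D) st ((i, Cl b) # xs)) ?A"
        using prob_scan_card_insert[OF 4(2)[OF neq, of True m']] Suc by simp
      have y: "hit ?y m' \<le> measure_pmf.prob (scan (insert i D) ((j, a) # st) xs) ?A"
        using prob_scan_card_insert[OF 4(3)[OF neq, of False m']] Suc by simp
      \<comment> \<open>Both outcomes are within one of the potential without stack top and current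
        symbol, hence within two of each other. The worse one is thus at most one above the current
        potential, \<open>Suc (min ?x ?y)\<close>.\<close>
      have "near ?x (del_dist (map snd st) (map snd xs))"
        using near_del_dist_Cons by simp
      moreover have "near ?y (del_dist (map snd st) (map snd xs))"
        using near_del_dist_stack[of "[]"] by simp
      ultimately have max: "max ?x ?y \<le> Suc (Suc (min ?x ?y))"
        by (auto simp: near_def)
      have "hit (Suc (min ?x ?y)) m = (hit (min ?x ?y) m' + hit (Suc (Suc (min ?x ?y))) m') / 2"
        using Suc by simp
      also have "\<dots> \<le> (hit (min ?x ?y) m' + hit (max ?x ?y) m') / 2"
        using hit_antimono_start[OF max] by simp
      also have "\<dots> = (hit ?x m' + hit ?y m') / 2"
        by (simp add: min_def max_def)
      also have "\<dots> \<le> (measure_pmf.prob (scan (insert j D) st ((i, Cl b) # xs)) ?A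
          + measure_pmf.prob (scan (insert i D) ((j, a) # st) xs) ?A) / 2"
        using x y by simp
      finally show ?thesis
        using neq by (simp add: prob_coin_bind prob_charge)
    qed
  qed
qed

section \<open>Running time and output\<close>

lemma set_pmf_charge: "(r, t) \<in> set_pmf (charge c p) \<longleftrightarrow> (\<exists>t'. t = c + t' \<and> (r, t') \<in> set_pmf p)"
  by (force simp: charge_def)

lemma scan_mismatch_cases:
  assumes "(D', t) \<in> set_pmf (scan D ((j, a) # st) ((i, Cl b) # xs))" and "a \<noteq> b"
  obtains (pop) t' where "t = 7 + t'"
      "(D', t') \<in> set_pmf (scan (insert j D) st ((i, Cl b) # xs))"
    | (skip) t' where "t = 7 + t'"
      "(D', t') \<in> set_pmf (scan (insert i D) ((j, a) # st) xs)"
  using assms by (auto simp: set_pmf_charge split: if_splits)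

lemma clear_stack_time: "snd (clear_stack D st) = 3 * length st + 1"
  by (induction D st rule: clear_stack.induct) (auto simp: case_prod_unfold Let_def)

text \<open>Each open parenthesis prepays the 7 units for its later removal from the stack.\<close>

lemma scan_time:
  "(D', t) \<in> set_pmf (scan D st xs) \<Longrightarrow> t \<le> 7 * length st + 14 * length xs + 2"
proof (induction D st xs arbitrary: D' t rule: scan.induct)
  case (1 D st)
  then show ?case
    using clear_stack_time[of D st] by (cases "clear_stack D st") (auto simp: set_pmf_charge)
next
  case (4 D j a st i b xs)
  show ?case
  proof (cases "a = b")
    case True
    then obtain t' where "t = 6 + t'" "(D', t') \<in> set_pmf (scan D st xs)"
      using 4(4) by (auto simp: set_pmf_charge)
    with 4(1)[OF True, of D' t'] show ?thesis by simp
  next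
    case False
    from 4(4) this show ?thesis
    proof (cases rule: scan_mismatch_cases)
      case (pop t')
      with 4(2)[OF False, of True D' t'] show ?thesis by simp
    next
      case (skip t')
      with 4(3)[OF False, of False D' t'] show ?thesis by simp
    qed
  qed
qed (fastforce simp: set_pmf_charge)+

lemma emit_time: "snd (emit D xs) \<le> 5 * length xs + 1"
  by (induction D xs rule: emit.induct) (auto simp: case_prod_unfold Let_def)

lemma emit_word: "fst (emit D xs) = map snd (filter (\<lambda>x. fst x \<notin> D) xs)"
  by (induction D xs rule: emit.induct) (auto simp: case_prod_unfold Let_def)

section \<open>Well-balancedness of the output\<close>

text \<open>Restores a matched pair, which is adjacent once everything between its two symbols has
  been matched or deleted.\<close>

lemma Dyck_insert_pair:
  assumes "w \<in> Dyck T" "w = A @ B" "a \<in> T"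
  shows "A @ [Op a, Cl a] @ B \<in> Dyck T"
  using assms(1,2)
proof (induction w arbitrary: A B rule: Dyck.induct)
  case (concat u v)
  from concat.prems consider us where "u = A @ us" "B = us @ v" | us where "A = u @ us" "v = us @ B"
    by (auto simp: append_eq_append_conv2)
  then show ?case
  proof cases
    case 1
    then show ?thesis
      using Dyck.concat[OF concat.IH(1)[of A us] concat.hyps(2)] by simp
  next
    case 2
    then show ?thesis
      using Dyck.concat[OF concat.hyps(1) concat.IH(2)[of us B]] by simp
  qed
next
  case empty
  then show ?case using Dyck.wrap[OF assms(3) Dyck.empty] by simp
next
  case (wrap b u)
  have pair: "[Op a, Cl a] \<in> Dyck T"
    using Dyck.wrap[OF assms(3) Dyck.empty] by simp
  have w: "[Op b] @ u @ [Cl b] \<in> Dyck T" using wrap.hyps by (rule Dyck.wrap)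
  \<comment> \<open>The insertion point lies before, after or inside the enclosing pair.\<close>
  consider "A = []" | "B = []" | A' B' where "A = Op b # A'" "B = B' @ [Cl b]"
    using wrap.prems by (cases A; cases B rule: rev_cases) auto
  then show ?case
  proof cases
    case 1
    then show ?thesis using Dyck.concat[OF pair w] wrap.prems by simp
  next
    case 2
    then show ?thesis using Dyck.concat[OF w pair] wrap.prems by auto
  next
    case 3
    then show ?thesis
      using Dyck.wrap[OF wrap.hyps(1) wrap.IH[of A' B']] wrap.prems by simp
  qed
qed

lemma fst_clear_stack: "fst (clear_stack D st) = D \<union> fst ` set st"
  by (induction D st rule: clear_stack.induct) (auto simp: case_prod_unfold Let_def)

text \<open>The part still to be balanced, in input order: the stack is stored top first and without
  the constructor \<open>Op\<close>.\<close>

definition pending :: "(nat \<times> 'a) list \<Rightarrow> (nat \<times> 'a paren) list \<Rightarrow> (nat \<times> 'a paren) list" where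
  "pending st xs = rev (map (apsnd Op) st) @ xs"

text \<open>The first inclusion keeps marks once set; by the second, positions gone from stack and
  input, such as those of a matched pair, are never marked later.\<close>

lemma scan_marks:
  "(D', t) \<in> set_pmf (scan D st xs) \<Longrightarrow> D \<subseteq> D' \<and> D' \<subseteq> D \<union> fst ` set st \<union> fst ` set xs"
proof (induction D st xs arbitrary: D' t rule: scan.induct)
  case (1 D st)
  then show ?case using fst_clear_stack[of D st] by (cases "clear_stack D st") (auto simp: set_pmf_charge)
next
  case (2 D st i a xs)
  then show ?case by (fastforce simp: set_pmf_charge)
next
  case (3 D i b xs)
  then show ?case by (fastforce simp: set_pmf_charge)
next
  case (4 D j a st i b xs)
  show ?case
  proof (cases "a = b")
    case True
    then obtain t' where "(D', t') \<in> set_pmf (scan D st xs)"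
      using 4(4) by (auto simp: set_pmf_charge)
    from 4(1)[OF True this] show ?thesis by auto
  next
    case False
    from 4(4) this show ?thesis
    proof (cases rule: scan_mismatch_cases)
      case (pop t')
      from 4(2)[OF False _ _ pop(2), of True] show ?thesis by auto
    next
      case (skip t')
      from 4(3)[OF False _ _ skip(2), of False] show ?thesis by auto
    qed
  qed
qed

text \<open>Going back through the run, a deleted symbol leaves the surviving word unchanged and a
  match inserts an adjacent pair between stack and input. Distinctness and disjointness keep matched
  positions unmarked.\<close>

lemma scan_Dyck:
  assumes "(D', t) \<in> set_pmf (scan D st xs)"
    and "distinct (map fst st @ map fst xs)"
    and "D \<inter> (fst ` set st \<union> fst ` set xs) = {}"
    and "snd ` set (pending st xs) \<subseteq> alphabet T"
  shows "map snd (filter (\<lambda>x. fst x \<notin> D') (pending st xs)) \<in> Dyck T"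
  using assms
proof (induction D st xs arbitrary: D' t rule: scan.induct)
  case (1 D st)
  then have "D' = D \<union> fst ` set st"
    using fst_clear_stack[of D st] by (cases "clear_stack D st") (auto simp: set_pmf_charge)
  then have "filter (\<lambda>x. fst x \<notin> D') (pending st []) = []"
    by (auto simp: pending_def filter_empty_conv)
  then show ?case using Dyck.empty by simp
next
  case (2 D st i a xs)
  obtain t' where t': "(D', t') \<in> set_pmf (scan D ((i, a) # st) xs)"
    using 2(2) by (auto simp: set_pmf_charge)
  have "pending ((i, a) # st) xs = pending st ((i, Op a) # xs)"
    by (simp add: pending_def)
  then show ?case using 2(1)[OF t'] 2(3-5) by auto
next
  case (3 D i b xs)
  obtain t' where t': "(D', t') \<in> set_pmf (scan (insert i D) [] xs)"
    using 3(2) by (auto simp: set_pmf_charge)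
  have "i \<in> D'" using scan_marks[OF t'] by auto
  then show ?case using 3(1)[OF t'] 3(3-5) by (auto simp: pending_def)
next
  case (4 D j a st i b xs)
  show ?case
  proof (cases "a = b")
    case True
    obtain t' where t': "(D', t') \<in> set_pmf (scan D st xs)"
      using 4(4) True by (auto simp: set_pmf_charge)
    have notin: "i \<notin> D'" "j \<notin> D'"
      using scan_marks[OF t'] 4(5,6) by auto
    have "a \<in> T" using 4(7) by (auto simp: pending_def alphabet_def)
    moreover have "map snd (filter (\<lambda>x. fst x \<notin> D') (pending st xs)) \<in> Dyck T"
      by (rule 4(1)[OF True t']) (use 4(5-7) in \<open>auto simp: pending_def\<close>)
    ultimately show ?thesis
      using notin True Dyck_insert_pair[OF _ refl, of
          "map snd (filter (\<lambda>x. fst x \<notin> D') (rev (map (apsnd Op) st)))"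
          "map snd (filter (\<lambda>x. fst x \<notin> D') xs)" T a]
      by (simp add: pending_def)
  next
    case False
    from 4(4) this show ?thesis
    proof (cases rule: scan_mismatch_cases)
      case (pop t')
      have "j \<in> D'" using scan_marks[OF pop(2)] by auto
      moreover have "map snd (filter (\<lambda>x. fst x \<notin> D') (pending st ((i, Cl b) # xs))) \<in> Dyck T"
        by (rule 4(2)[OF False _ _ pop(2), of True]) (use 4(5-7) in \<open>auto simp: pending_def\<close>)
      ultimately show ?thesis by (simp add: pending_def)
    next
      case (skip t')
      have "i \<in> D'" using scan_marks[OF skip(2)] by auto
      moreover have "map snd (filter (\<lambda>x. fst x \<notin> D') (pending ((j, a) # st) xs)) \<in> Dyck T"
        by (rule 4(3)[OF False _ _ skip(2), of False]) (use 4(5-7) in \<open>auto simp: pending_def\<close>)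
      ultimately show ?thesis by (simp add: pending_def split: if_splits)
    qed
  qed
qed

section \<open>Bounds for the whole algorithm\<close>

text \<open>Each symbol costs 1 for initialisation, at most 14 for the scan and at most 5 for the
  output; the constant terms sum to 4.\<close>

lemma random_deletion_time:
  assumes "(w, t) \<in> set_pmf (random_deletion \<sigma>)"
  shows "t \<le> 20 * (length \<sigma> + 1)"
proof -
  obtain D t' where "(D, t') \<in> set_pmf (scan {} [] (List.enumerate 0 \<sigma>))"
    and "t = length \<sigma> + 1 + (t' + snd (emit D (List.enumerate 0 \<sigma>)))"
    using assms by (fastforce simp: random_deletion_def set_pmf_charge
        dest: arg_cong[where f = snd])
  then show ?thesis
    using scan_time[of D t' "{}" "[]"] emit_time[of D "List.enumerate 0 \<sigma>"] by fastforce
qed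

lemma edit_dist_emit:
  assumes "finite D"
  shows "edit_dist \<sigma> (fst (emit D (List.enumerate 0 \<sigma>))) \<le> card D"
proof -
  let ?xs = "List.enumerate 0 \<sigma>"
  let ?del = "filter (\<lambda>x. fst x \<in> D) ?xs"
  have "(edit_step ^^ length ?del) \<sigma> (fst (emit D ?xs))"
    using edit_steps_filter[of "\<lambda>x. fst x \<in> D" ?xs snd] by (simp add: emit_word)
  then have "edit_dist \<sigma> (fst (emit D ?xs)) \<le> length ?del"
    unfolding edit_dist_def by (rule Least_le)
  \<comment> \<open>Distinct positions make the number of removed symbols a cardinality.\<close>
  also have "distinct (map fst ?del)"
    by (simp add: distinct_map_filter)
  then have "length ?del = card (set (map fst ?del))"
    by (metis distinct_card length_map)
  also have "\<dots> \<le> card D"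
    by (rule card_mono) (use assms in auto)
  finally show ?thesis .
qed

lemma prob_random_deletion:
  assumes "\<sigma> \<in> lists (alphabet T)"
  shows "hit (del_dist [] \<sigma>) m
    \<le> measure_pmf.prob (random_deletion \<sigma>) {(w, t). w \<in> Dyck T \<and> edit_dist \<sigma> w \<le> m}"
proof -
  let ?xs = "List.enumerate 0 \<sigma>"
  let ?out = "\<lambda>D. fst (emit D ?xs)"
  have "hit (del_dist [] \<sigma>) m \<le> measure_pmf.prob (scan {} [] ?xs) {(D, t). card D \<le> m}"
    using prob_scan_card[of "[]" ?xs m "{}"] by simp
  also have "\<dots> \<le> measure_pmf.prob (scan {} [] ?xs)
      {(D, t). ?out D \<in> Dyck T \<and> edit_dist \<sigma> (?out D) \<le> m}"
  proof (rule measure_pmf.finite_measure_mono_AE)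
    have "?out D \<in> Dyck T \<and> edit_dist \<sigma> (?out D) \<le> m"
      if D: "(D, t) \<in> set_pmf (scan {} [] ?xs)" and "card D \<le> m" for D t
    proof
      have "snd ` set ?xs \<subseteq> alphabet T"
        using assms by (metis in_listsD list.set_map map_snd_enumerate subsetI)
      then show "?out D \<in> Dyck T"
        using scan_Dyck[OF D, of T] by (simp add: pending_def emit_word)
      have "finite D"
        using scan_marks[OF D] by (auto intro: finite_subset)
      then show "edit_dist \<sigma> (?out D) \<le> m"
        using edit_dist_emit \<open>card D \<le> m\<close> order_trans by blast
    qed
    then show "AE x in scan {} [] ?xs. x \<in> {(D, t). card D \<le> m} \<longrightarrow>
        x \<in> {(D, t). ?out D \<in> Dyck T \<and> edit_dist \<sigma> (?out D) \<le> m}"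
      by (auto simp: AE_measure_pmf_iff)
  qed simp
  \<comment> \<open>After the scan everything is deterministic, so the result is an image of the
    distribution of \<open>scan\<close>.\<close>
  also have "random_deletion \<sigma> = charge (length \<sigma> + 1)
      (map_pmf (\<lambda>(D, t). (?out D, t + snd (emit D ?xs))) (scan {} [] ?xs))"
    by (simp add: random_deletion_def charge_def map_pmf_def bind_return_pmf case_prod_unfold)
  then have "measure_pmf.prob (scan {} [] ?xs) {(D, t). ?out D \<in> Dyck T \<and> edit_dist \<sigma> (?out D) \<le> m}
      = measure_pmf.prob (random_deletion \<sigma>) {(w, t). w \<in> Dyck T \<and> edit_dist \<sigma> w \<le> m}"
    by (simp only: prob_charge[of _ _ "\<lambda>w. w \<in> Dyck T \<and> edit_dist \<sigma> w \<le> m"] measure_map_pmf)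
      (simp add: vimage_def case_prod_unfold)
  finally show ?thesis .
qed

theorem theorem1:
  "\<exists>(p::real) > 0. \<exists>C::nat. \<forall>(s::nat) (T :: 'a set) (n::nat) (\<sigma> :: 'a paren list) (d::nat).
     s \<ge> 2 \<longrightarrow> finite T \<longrightarrow> card T = s \<longrightarrow>
     \<sigma> \<in> lists (alphabet T) \<longrightarrow> length \<sigma> = n \<longrightarrow>
     d = edit_dist_lang \<sigma> (Dyck T) \<longrightarrow>
       (\<forall>(w, t) \<in> set_pmf (random_deletion \<sigma>). t \<le> C * (n + 1)) \<and>
       measure_pmf.prob (random_deletion \<sigma>)
         {(w, t). w \<in> Dyck T \<and> edit_dist \<sigma> w \<le> (4 * d) * d} \<ge> p"
proof (intro exI conjI allI impI)
  show "(1 / 6 :: real) ^ 12 > 0" by simp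
next
  fix s n d :: nat and T :: "'a set" and \<sigma> :: "'a paren list"
  assume \<sigma>: "\<sigma> \<in> lists (alphabet T)" and n: "length \<sigma> = n"
    and d: "d = edit_dist_lang \<sigma> (Dyck T)"
  show "\<forall>(w, t) \<in> set_pmf (random_deletion \<sigma>). t \<le> 20 * (n + 1)"
    using random_deletion_time n by blast
  \<comment> \<open>The walk starts at the largest possible potential \<open>2 * d\<close>, and its
    time \<open>(2 * d)\<^sup>2\<close> is exactly the claimed bound.\<close>
  have "(1 / 6) ^ 12 \<le> hit (2 * d) ((2 * d)\<^sup>2)" by (rule hit_square)
  also have "\<dots> = hit (2 * d) (4 * d * d)" by (simp add: power2_eq_square mult.assoc)
  also have "\<dots> \<le> hit (del_dist [] \<sigma>) (4 * d * d)"
    using del_dist_le_edit_dist_lang d by (intro hit_antimono_start) blast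
  also have "\<dots> \<le> measure_pmf.prob (random_deletion \<sigma>)
      {(w, t). w \<in> Dyck T \<and> edit_dist \<sigma> w \<le> (4 * d) * d}"
    using \<sigma> by (rule prob_random_deletion)
  finally show "(1 / 6) ^ 12 \<le> measure_pmf.prob (random_deletion \<sigma>)
      {(w, t). w \<in> Dyck T \<and> edit_dist \<sigma> w \<le> (4 * d) * d}" .
qed

end
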